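(* Let $G$ be a finite totally $2$-closed group and let $N$ be a normal abelian subgroup of $G$. Then $N$ is cyclic.
   Context: All groups are finite and nontrivial. If a group $G$ acts faithfully on a finite set $\Omega$ (a faithful $G$-set), then $G$ is identified with its image in $\mathrm{Sym}(\Omega)$, and $G$ acts on $\Omega^2=\Omega\times\Omega$ by $(\alpha,\beta)^g=(\alpha^g,\beta^g)$. The $2$-closure $G^{(2),\Omega}$ is the largest subgroup of $\mathrm{Sym}(\Omega)$ leaving each orbit of $G$ on $\Omega^2$ invariant. A finite group $G$ is totally $2$-closed if $G=G^{(2),\Omega}$ for every finite faithful $G$-set $\Omega$. *)

theory Defs
  imports "HOL-Algebra.Algebra"
begin

text \<open>
  \<^const>\<open>group_action\<close> is a homomorphism into \<^term>\<open>BijGroup \<Omega>\<close>, i.e. a left action. For a right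
  action written \<open>\<alpha>\<^sup>g\<close>, the left action \<open>g \<mapsto> (\<alpha> \<mapsto> \<alpha> acted on by g\<inverse>)\<close> has the same image in
  \<open>Sym(\<Omega>)\<close>, hence the same orbits and the same 2-closure.
\<close>

definition two_orbits ::
    "('a, 'c) monoid_scheme \<Rightarrow> 'b set \<Rightarrow> ('a \<Rightarrow> 'b \<Rightarrow> 'b) \<Rightarrow> ('b \<times> 'b) set set"
  where "two_orbits G \<Omega> \<phi> = orbits G (\<Omega> \<times> \<Omega>) (\<lambda>g. map_prod (\<phi> g) (\<phi> g))"

definition two_closure ::
    "('a, 'c) monoid_scheme \<Rightarrow> 'b set \<Rightarrow> ('a \<Rightarrow> 'b \<Rightarrow> 'b) \<Rightarrow> ('b \<Rightarrow> 'b) set"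
  where "two_closure G \<Omega> \<phi> =
    (GREATEST H. subgroup H (BijGroup \<Omega>) \<and>
       (\<forall>f\<in>H. \<forall>\<Delta>\<in>two_orbits G \<Omega> \<phi>. map_prod f f ` \<Delta> = \<Delta>))"

text \<open>
  A definition cannot quantify over types, so \<open>\<Omega>\<close> ranges over the finite sets of natural numbers.
  Every finite set is in bijection with one of these; lemma \<open>totally_two_closedD\<close> below derives
  the condition for finite faithful \<open>G\<close>-sets over an arbitrary type.
\<close>

definition totally_two_closed :: "('a, 'c) monoid_scheme \<Rightarrow> bool"
  where "totally_two_closed G \<longleftrightarrow>
    (\<forall>(\<Omega> :: nat set) \<phi>. finite \<Omega> \<longrightarrow> faithful_action G \<Omega> \<phi> \<longrightarrow>
       \<phi> ` carrier G = two_closure G \<Omega> \<phi>)"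

lemma BijGroup_simps:
  "carrier (BijGroup S) = Bij S"
  "f \<in> Bij S \<Longrightarrow> g \<in> Bij S \<Longrightarrow> f \<otimes>\<^bsub>BijGroup S\<^esub> g = compose S f g"
  "\<one>\<^bsub>BijGroup S\<^esub> = (\<lambda>x\<in>S. x)"
  by (simp_all add: BijGroup_def)

lemma two_orbits_subset:
  assumes "group_action G \<Omega> \<phi>" "\<Delta> \<in> two_orbits G \<Omega> \<phi>"
  shows "\<Delta> \<subseteq> \<Omega> \<times> \<Omega>"
  using assms group_action.element_image[OF assms(1)]
  by (fastforce simp: two_orbits_def orbits_def orbit_def)

lemma subgroup_preserving:
  assumes sub: "\<And>\<Delta>. \<Delta> \<in> D \<Longrightarrow> \<Delta> \<subseteq> \<Omega> \<times> \<Omega>"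
  shows "subgroup {f \<in> Bij \<Omega>. \<forall>\<Delta>\<in>D. map_prod f f ` \<Delta> = \<Delta>} (BijGroup \<Omega>)"
    (is "subgroup ?H _")
proof (rule subgroup.intro)
  show "?H \<subseteq> carrier (BijGroup \<Omega>)"
    by (auto simp: BijGroup_simps)
next
  fix f g assume f: "f \<in> ?H" and g: "g \<in> ?H"
  have "map_prod (compose \<Omega> f g) (compose \<Omega> f g) ` \<Delta> = \<Delta>" if "\<Delta> \<in> D" for \<Delta>
  proof -
    have "map_prod (compose \<Omega> f g) (compose \<Omega> f g) ` \<Delta> = map_prod f f ` map_prod g g ` \<Delta>"
      unfolding image_image using sub[OF that]
      by (intro image_cong) (auto simp: compose_eq)
    then show ?thesis using f g that by simp
  qed
  then show "f \<otimes>\<^bsub>BijGroup \<Omega>\<^esub> g \<in> ?H"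
    using f g by (simp add: BijGroup_simps compose_Bij)
next
  have "map_prod (\<lambda>x\<in>\<Omega>. x) (\<lambda>x\<in>\<Omega>. x) ` \<Delta> = \<Delta>" if "\<Delta> \<in> D" for \<Delta>
  proof -
    have "map_prod (\<lambda>x\<in>\<Omega>. x) (\<lambda>x\<in>\<Omega>. x) ` \<Delta> = (\<lambda>x. x) ` \<Delta>"
      using sub[OF that] by (intro image_cong) auto
    then show ?thesis by simp
  qed
  then show "\<one>\<^bsub>BijGroup \<Omega>\<^esub> \<in> ?H"
    by (simp add: BijGroup_simps id_Bij)
next
  fix f assume f: "f \<in> ?H"
  let ?k = "\<lambda>x\<in>\<Omega>. inv_into \<Omega> f x"
  have inj: "inj_on f \<Omega>" using f by (auto simp: Bij_def bij_betw_def)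
  have "map_prod ?k ?k ` \<Delta> = \<Delta>" if "\<Delta> \<in> D" for \<Delta>
  proof -
    have "f x \<in> \<Omega>" if "x \<in> \<Omega>" for x
      using f that by (auto simp: Bij_def bij_betw_def)
    then have "map_prod ?k ?k ` map_prod f f ` \<Delta> = (\<lambda>x. x) ` \<Delta>"
      unfolding image_image using sub[OF that] inj
      by (intro image_cong) auto
    then show ?thesis using f that by simp
  qed
  then show "inv\<^bsub>BijGroup \<Omega>\<^esub> f \<in> ?H"
    using f by (simp add: inv_BijGroup restrict_inv_into_Bij)
qed

lemma two_closure_eq:
  assumes "group_action G \<Omega> \<phi>"
  shows "two_closure G \<Omega> \<phi> =
    {f \<in> Bij \<Omega>. \<forall>\<Delta>\<in>two_orbits G \<Omega> \<phi>. map_prod f f ` \<Delta> = \<Delta>}"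
  unfolding two_closure_def
proof (rule Greatest_equality)
  show "subgroup {f \<in> Bij \<Omega>. \<forall>\<Delta>\<in>two_orbits G \<Omega> \<phi>. map_prod f f ` \<Delta> = \<Delta>} (BijGroup \<Omega>) \<and>
    (\<forall>f\<in>{f \<in> Bij \<Omega>. \<forall>\<Delta>\<in>two_orbits G \<Omega> \<phi>. map_prod f f ` \<Delta> = \<Delta>}.
       \<forall>\<Delta>\<in>two_orbits G \<Omega> \<phi>. map_prod f f ` \<Delta> = \<Delta>)"
    using subgroup_preserving two_orbits_subset[OF assms] by blast
next
  fix H assume "subgroup H (BijGroup \<Omega>) \<and>
    (\<forall>f\<in>H. \<forall>\<Delta>\<in>two_orbits G \<Omega> \<phi>. map_prod f f ` \<Delta> = \<Delta>)"
  then show "H \<subseteq> {f \<in> Bij \<Omega>. \<forall>\<Delta>\<in>two_orbits G \<Omega> \<phi>. map_prod f f ` \<Delta> = \<Delta>}"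
    using subgroup.subset by (fastforce simp: BijGroup_simps)
qed

lemma image_subset_two_closure:
  assumes act: "group_action G \<Omega> \<phi>"
  shows "\<phi> ` carrier G \<subseteq> two_closure G \<Omega> \<phi>"
proof
  fix f assume "f \<in> \<phi> ` carrier G"
  then obtain g where g: "g \<in> carrier G" "f = \<phi> g" by blast
  interpret group_action G \<Omega> \<phi> by (fact act)
  interpret group G using group_hom group_hom.axioms(1) by blast
  have "map_prod f f ` \<Delta> = \<Delta>" if D: "\<Delta> \<in> two_orbits G \<Omega> \<phi>" for \<Delta>
  proof -
    obtain a b where ab: "a \<in> \<Omega>" "b \<in> \<Omega>"
      and \<Delta>: "\<Delta> = {map_prod (\<phi> k) (\<phi> k) (a, b) | k. k \<in> carrier G}"
      using D by (auto simp: two_orbits_def orbits_def orbit_def)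
    show ?thesis
    proof (intro equalityI subsetI)
      fix p assume "p \<in> map_prod f f ` \<Delta>"
      then obtain k where k: "k \<in> carrier G" "p = (\<phi> g (\<phi> k a), \<phi> g (\<phi> k b))"
        using \<Delta> g by auto
      then have "p = map_prod (\<phi> (g \<otimes>\<^bsub>G\<^esub> k)) (\<phi> (g \<otimes>\<^bsub>G\<^esub> k)) (a, b)"
        using ab g composition_rule by simp
      then show "p \<in> \<Delta>" using \<Delta> g k by blast
    next
      fix p assume "p \<in> \<Delta>"
      then obtain k where k: "k \<in> carrier G" "p = map_prod (\<phi> k) (\<phi> k) (a, b)"
        using \<Delta> by blast
      let ?m = "inv\<^bsub>G\<^esub> g \<otimes>\<^bsub>G\<^esub> k"
      have m: "?m \<in> carrier G" using g k by simp
      have "k = g \<otimes>\<^bsub>G\<^esub> ?m" using g k by (simp add: m_assoc[symmetric])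
      then have "p = map_prod f f (map_prod (\<phi> ?m) (\<phi> ?m) (a, b))"
        using k(2) ab g m composition_rule by (metis map_prod_simp)
      then show "p \<in> map_prod f f ` \<Delta>" using \<Delta> m by blast
    qed
  qed
  then show "f \<in> two_closure G \<Omega> \<phi>"
    using g bij_prop0 by (simp add: two_closure_eq[OF act])
qed

lemma totally_two_closedD:
  fixes \<Omega> :: "'b set"
  assumes closed: "totally_two_closed G" and fin: "finite \<Omega>" and faith: "faithful_action G \<Omega> \<phi>"
  shows "\<phi> ` carrier G = two_closure G \<Omega> \<phi>"
proof (rule equalityI)
  interpret faithful_action G \<Omega> \<phi> by (fact faith)
  have act: "group_action G \<Omega> \<phi>" by (fact group_action_axioms)
  interpret group G using group_hom group_hom.axioms(1) by blast
  show "\<phi> ` carrier G \<subseteq> two_closure G \<Omega> \<phi>"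
    by (rule image_subset_two_closure[OF act])
  obtain h :: "'b \<Rightarrow> nat" where h: "inj_on h \<Omega>"
    using finite_imp_inj_to_nat_seg[OF fin] by blast
  define W where "W = h ` \<Omega>"
  define k where "k = inv_into \<Omega> h"
  define c where "c f = (\<lambda>y\<in>W. h (f (k y)))" for f
  have kh [simp]: "k (h x) = x" if "x \<in> \<Omega>" for x
    using h that by (simp add: k_def)
  have hW: "h x \<in> W" if "x \<in> \<Omega>" for x using that by (simp add: W_def)
  have ch [simp]: "c f (h x) = h (f x)" if "x \<in> \<Omega>" for f x
    using that by (simp add: c_def hW)
  have fin_W: "finite W" using fin by (simp add: W_def)
  have cBij: "c f \<in> Bij W" if f: "f \<in> Bij \<Omega>" for f
  proof -
    have "bij_betw f \<Omega> \<Omega>" using f by (simp add: Bij_def)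
    moreover have "bij_betw h \<Omega> W" using h by (simp add: W_def bij_betw_def)
    moreover from this have "bij_betw k W \<Omega>" by (simp add: k_def bij_betw_inv_into)
    ultimately have "bij_betw (h \<circ> f \<circ> k) W W" by (meson bij_betw_trans)
    then have "bij_betw (c f) W W"
      by (rule bij_betw_cong[THEN iffD1, rotated]) (simp add: c_def)
    then show ?thesis by (simp add: Bij_def c_def)
  qed
  have c_inj: "f = f'" if "f \<in> Bij \<Omega>" "f' \<in> Bij \<Omega>" "c f = c f'" for f f'
  proof (rule extensionalityI[of _ \<Omega>])
    show "f \<in> extensional \<Omega>" "f' \<in> extensional \<Omega>" using that by (auto simp: Bij_def)
    fix x assume x: "x \<in> \<Omega>"
    have "h (f x) = h (f' x)" using that(3) ch[OF x] by metis
    moreover have "f x \<in> \<Omega>" "f' x \<in> \<Omega>" using that x by (auto simp: Bij_def bij_betw_def)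
    ultimately show "f x = f' x" using h by (meson inj_onD)
  qed
  define \<psi> where "\<psi> g = c (\<phi> g)" for g
  have faith': "faithful_action G W \<psi>"
  proof (intro faithful_action.intro group_action.intro faithful_action_axioms.intro group_hom.intro
      group_BijGroup group_hom_axioms.intro homI)
    show "group G" ..
    fix x assume "x \<in> carrier G"
    then show "\<psi> x \<in> carrier (BijGroup W)"
      by (simp add: \<psi>_def BijGroup_simps cBij bij_prop0)
  next
    fix x y assume xy: "x \<in> carrier G" "y \<in> carrier G"
    have "c (\<phi> (x \<otimes>\<^bsub>G\<^esub> y)) = compose W (c (\<phi> x)) (c (\<phi> y))"
    proof (rule extensionalityI[of _ W])
      fix w assume "w \<in> W"
      then obtain a where a: "a \<in> \<Omega>" "w = h a" by (auto simp: W_def)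
      have "\<phi> y a \<in> \<Omega>" using element_image xy a by blast
      then show "c (\<phi> (x \<otimes>\<^bsub>G\<^esub> y)) w = compose W (c (\<phi> x)) (c (\<phi> y)) w"
        using xy a by (simp add: compose_eq hW composition_rule)
    qed (auto simp: c_def)
    then show "\<psi> (x \<otimes>\<^bsub>G\<^esub> y) = \<psi> x \<otimes>\<^bsub>BijGroup W\<^esub> \<psi> y"
      using xy by (simp add: \<psi>_def BijGroup_simps cBij bij_prop0)
  next
    show "inj_on \<psi> (carrier G)"
      using faithful c_inj bij_prop0 unfolding inj_on_def \<psi>_def by blast
  qed
  then have act': "group_action G W \<psi>" by (rule faithful_action.axioms)
  have cl: "\<psi> ` carrier G = two_closure G W \<psi>"
    using closed fin_W faith' by (simp add: totally_two_closed_def)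
  show "two_closure G \<Omega> \<phi> \<subseteq> \<phi> ` carrier G"
  proof
    fix f assume "f \<in> two_closure G \<Omega> \<phi>"
    then have f: "f \<in> Bij \<Omega>" "\<And>\<Delta>. \<Delta> \<in> two_orbits G \<Omega> \<phi> \<Longrightarrow> map_prod f f ` \<Delta> = \<Delta>"
      by (auto simp: two_closure_eq[OF act])
    have "map_prod (c f) (c f) ` \<Delta>' = \<Delta>'" if D': "\<Delta>' \<in> two_orbits G W \<psi>" for \<Delta>'
    proof -
      obtain a b where ab: "a \<in> \<Omega>" "b \<in> \<Omega>"
        and \<Delta>': "\<Delta>' = {map_prod (\<psi> g) (\<psi> g) (h a, h b) | g. g \<in> carrier G}"
        using D' by (auto simp: two_orbits_def orbits_def orbit_def W_def)
      define \<Delta> where "\<Delta> = {map_prod (\<phi> g) (\<phi> g) (a, b) | g. g \<in> carrier G}"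
      have \<Delta>: "\<Delta> \<in> two_orbits G \<Omega> \<phi>"
        unfolding \<Delta>_def two_orbits_def orbits_def orbit_def using ab by blast
      have eq: "\<Delta>' = map_prod h h ` \<Delta>"
        using ab by (auto simp: \<Delta>' \<Delta>_def \<psi>_def image_def)
      have "map_prod (c f) (c f) ` \<Delta>' = map_prod h h ` map_prod f f ` \<Delta>"
        unfolding eq image_image using two_orbits_subset[OF act \<Delta>]
        by (intro image_cong) auto
      then show ?thesis using f(2)[OF \<Delta>] eq by simp
    qed
    then have "c f \<in> \<psi> ` carrier G"
      unfolding cl two_closure_eq[OF act'] using cBij[OF f(1)] by blast
    then show "f \<in> \<phi> ` carrier G"
      using c_inj[OF f(1)] bij_prop0 by (auto simp: \<psi>_def)
  qed
qed

end

theory Submission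
  imports Defs
begin

text \<open>
  If \<open>N\<close> is not cyclic, then for some prime \<open>p\<close> the subgroup \<open>V\<close> of elements of \<open>N\<close> killed by \<open>p\<close> is
  not cyclic, and \<open>V\<close> is normal in \<open>G\<close>. Let \<open>G\<close> act by left multiplication on the disjoint union of
  the coset spaces \<open>G/K\<close> over all maximal subgroups \<open>K\<close> of \<open>V\<close>. A left coset of \<open>K\<close> is a right coset
  of a conjugate of \<open>K\<close>, so a point of this \<open>G\<close>-set is a right coset \<open>Kg\<close>, and \<open>K\<close> is its stabilizer
  in \<open>V\<close>. Fix \<open>K\<^sub>0\<close> and \<open>v \<in> V - K\<^sub>0\<close>, and let \<open>f\<close> act as \<open>v\<close> on the right cosets of \<open>K\<^sub>0\<close> and
  trivially elsewhere. Since \<open>KL = V\<close> for distinct maximal \<open>K\<close>, \<open>L\<close>, on each pair of points \<open>f\<close>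
  agrees with some element of \<open>V\<close>; hence \<open>f\<close> lies in the 2-closure. An element of \<open>G\<close> inducing \<open>f\<close>
  would lie in every maximal \<open>K \<noteq> K\<^sub>0\<close>; as \<open>V\<close> is elementary abelian and not cyclic, the
  intersection of these is trivial for a suitable \<open>K\<^sub>0\<close>, a contradiction.
\<close>

section \<open>Maximal subgroups, cyclic subgroups and elements of prime order\<close>

definition maximal_subgroups :: "('a, 'c) monoid_scheme \<Rightarrow> 'a set set"
  where "maximal_subgroups G =
    {K. subgroup K G \<and> K \<noteq> carrier G \<and>
      (\<forall>L. subgroup L G \<longrightarrow> K \<subseteq> L \<longrightarrow> L = K \<or> L = carrier G)}"

text \<open>Bezout writes \<open>x\<close> as a product of powers of \<open>x [^] m\<close> and
  \<open>x [^] n\<close>. The typical use has a prime \<open>p\<close> with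
  \<open>x [^] p = \<one>\<close> as one exponent: a power of \<open>x\<close> in \<open>K\<close>
  whose exponent is prime to \<open>p\<close> puts \<open>x\<close> itself in
  \<open>K\<close>.\<close>

lemma (in group) mem_of_coprime_int_pow_mem:
  assumes "subgroup K G" "x \<in> carrier G" "x [^] m \<in> K" "x [^] n \<in> K" "coprime m (n::int)"
  shows "x \<in> K"
proof -
  obtain a b where ab: "a * m + b * n = 1"
    using assms(5) bezout_int[of m n] by auto
  interpret K: subgroup K G by fact
  have "x [^] (m * a + n * b) \<in> K"
    using assms subgroup_int_pow_closed[OF assms(1)] by (simp add: int_pow_mult flip: int_pow_pow)
  then show ?thesis using ab assms(2) by (simp add: mult.commute)
qed

lemma (in group) generate_singleton_subset_iff:
  assumes "subgroup K G" "x \<in> carrier G"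
  shows "generate G {x} \<subseteq> K \<longleftrightarrow> x \<in> K"
  using assms generate_subgroup_incl[of "{x}" K] generate.incl[of x "{x}" G] by blast

lemma (in group) int_pow_mem_generate:
  "x \<in> carrier G \<Longrightarrow> x [^] (k::int) \<in> generate G {x}"
  by (auto simp: generate_pow)

text \<open>Take a generator of a cyclic subgroup that is maximal under inclusion among the cyclic
  ones; \<open>g \<in> generate G {h}\<close> expresses that inclusion through elements.\<close>

lemma (in group) exists_maximal_cyclic_subgroup:
  assumes "finite (carrier G)"
  obtains g where "g \<in> carrier G"
    "\<And>h. h \<in> carrier G \<Longrightarrow> g \<in> generate G {h} \<Longrightarrow> h \<in> generate G {g}"
proof -
  let ?C = "(\<lambda>g. generate G {g}) ` carrier G"
  obtain C where C: "C \<in> ?C" "\<forall>D\<in>?C. C \<subseteq> D \<longrightarrow> C = D"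
    using finite_has_maximal[of ?C] assms by blast
  then obtain g where g: "g \<in> carrier G" "C = generate G {g}" by blast
  show thesis
  proof
    show "g \<in> carrier G" by fact
    fix h assume h: "h \<in> carrier G" "g \<in> generate G {h}"
    then have "C \<subseteq> generate G {h}"
      using g generate_singleton_subset_iff generate_is_subgroup[of "{h}"] by blast
    then have "C = generate G {h}" using C(2) h(1) by blast
    then show "h \<in> generate G {g}" using g(2) generate.incl[of h "{h}" G] by simp
  qed
qed

text \<open>Let \<open>m\<close> be the least positive exponent with \<open>x [^] m\<close> in
  \<open>K\<close>, and \<open>p\<close> a prime divisor of \<open>m\<close>. Then
  \<open>y = x [^] (m div p)\<close> works by minimality.\<close>

lemma (in group) exists_prime_pow_mem_subgroup:
  assumes "subgroup K G" "finite (carrier G)" "x \<in> carrier G" "x \<notin> K"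
  obtains y p where "y \<in> carrier G" "y \<notin> K" "Factorial_Ring.prime (p::nat)" "y [^] p \<in> K"
proof -
  interpret K: subgroup K G by fact
  define m where "m = (LEAST m::nat. m > 0 \<and> x [^] m \<in> K)"
  have "ord x > 0 \<and> x [^] ord x \<in> K" using assms ord_ge_1[OF assms(2,3)] by auto
  then have m: "m > 0 \<and> x [^] m \<in> K" unfolding m_def by (rule LeastI)
  have least: "x [^] n \<notin> K" if "0 < n" "n < m" for n
    using not_less_Least[of n "\<lambda>m. m > 0 \<and> x [^] m \<in> K"] that unfolding m_def by blast
  have "m \<noteq> 1" using m assms by auto
  then obtain p where p: "Factorial_Ring.prime p" "p dvd m" using prime_factor_nat by blast
  show thesis
  proof
    show "x [^] (m div p) \<in> carrier G" using assms by simp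
    show "Factorial_Ring.prime p" by fact
    show "(x [^] (m div p)) [^] p \<in> K" using m p assms by (simp add: nat_pow_pow)
    have "0 < m div p" "m div p < m"
      using m p prime_gt_1_nat[OF p(1)] by (simp_all add: dvd_imp_le div_greater_zero_iff)
    then show "x [^] (m div p) \<notin> K" by (rule least)
  qed
qed

text \<open>A maximal cyclic subgroup \<open>C\<close>, generated by \<open>g\<close>, is proper, so
  some \<open>y\<close> outside \<open>C\<close> has \<open>y [^] p\<close> in \<open>C\<close>.
  Dividing \<open>y\<close> by a \<open>p\<close>-th root of \<open>y [^] p\<close> taken in
  \<open>C\<close> gives \<open>z\<close>; the power \<open>w\<close> of \<open>g\<close> of order
  \<open>p\<close> generates a subgroup of \<open>C\<close>, which misses \<open>z\<close>.\<close>

lemma (in comm_group) not_cyclic_obtains_prime_order: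
  assumes fin: "finite (carrier G)" and "\<not> cyclic_group G"
  obtains p z w where "Factorial_Ring.prime (p::nat)" "z \<in> carrier G" "w \<in> carrier G" "z [^] p = \<one>" "w [^] p = \<one>"
    "w \<noteq> \<one>" "z \<notin> generate G {w}"
proof -
  obtain g where g: "g \<in> carrier G"
    and max: "\<And>h. h \<in> carrier G \<Longrightarrow> g \<in> generate G {h} \<Longrightarrow> h \<in> generate G {g}"
    using exists_maximal_cyclic_subgroup[OF fin] by metis
  define C where "C = generate G {g}"
  have subC: "subgroup C G" unfolding C_def using g by (simp add: generate_is_subgroup)
  interpret C: subgroup C G by fact
  have gC: "g [^] k \<in> C" for k :: int using g by (simp add: C_def int_pow_mem_generate)
  have gC1: "g \<in> C" using gC[of 1] g by simp
  have "C \<noteq> carrier G"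
    using assms(2) g unfolding cyclic_group C_def by (auto simp: generate_pow full_SetCompr_eq)
  then obtain x where "x \<in> carrier G" "x \<notin> C" using C.subset by blast
  then obtain y p where y: "y \<in> carrier G" "y \<notin> C" and p: "Factorial_Ring.prime (p::nat)" and yp: "y [^] p \<in> C"
    using exists_prime_pow_mem_subgroup[OF subC fin] by metis
  have ip: "Factorial_Ring.prime (int p)" using p by simp
  obtain k :: int where k: "y [^] p = g [^] k"
    using yp g by (auto simp: C_def generate_pow)
  have "\<exists>t\<in>C. t [^] p = y [^] p"
  proof (cases "int p dvd k")
    case True
    then obtain j where "k = j * int p" by (metis dvd_div_mult_self)
    then have "(g [^] j) [^] p = y [^] p"
      using g k by (metis int_pow_int int_pow_pow)
    then show ?thesis using gC by blast
  next
    case False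
    then have "coprime (int p) k" using ip prime_imp_coprime by blast
    then obtain a b where ab: "a * int p + b * k = 1"
      using bezout_int[of "int p" k] by auto
    \<comment> \<open>By the choice of \<open>a\<close> and \<open>b\<close>, \<open>u\<close> is a
      \<open>p\<close>-th root of \<open>g\<close>. Maximality of \<open>C\<close> then forces
      \<open>u\<close> into \<open>C\<close>, and \<open>u [^] k\<close> is the root wanted for
      \<open>y [^] p\<close>.\<close>
    define u where "u = g [^] a \<otimes> y [^] b"
    have u: "u \<in> carrier G" using g y by (simp add: u_def)
    have "u [^] int p = (g [^] a) [^] int p \<otimes> (y [^] b) [^] int p"
      using g y by (simp add: u_def int_pow_distrib)
    also have "(y [^] b) [^] int p = (y [^] int p) [^] b"
      using y by (simp add: int_pow_pow mult.commute)
    also have "(y [^] int p) [^] b = g [^] (k * b)"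
      using g k by (simp add: int_pow_int int_pow_pow)
    also have "(g [^] a) [^] int p \<otimes> g [^] (k * b) = g [^] (a * int p + k * b)"
      using g by (simp add: int_pow_pow int_pow_mult)
    also have "\<dots> = g" using ab g by (simp add: mult.commute)
    finally have ug: "u [^] int p = g" .
    then have "g \<in> generate G {u}" using int_pow_mem_generate[OF u, of "int p"] by simp
    then have uC: "u \<in> C" using max[OF u] by (simp add: C_def)
    have "(u [^] k) [^] int p = (u [^] int p) [^] k"
      using u by (simp add: int_pow_pow mult.commute)
    then have "(u [^] k) [^] p = y [^] p" using ug k by (simp add: int_pow_int)
    moreover have "u [^] k \<in> C" using subgroup_int_pow_closed[OF subC uC] .
    ultimately show ?thesis by blast
  qed
  then obtain t where t: "t \<in> C" "t [^] p = y [^] p" by blast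
  have tG: "t \<in> carrier G" using t by simp
  define z where "z = y \<otimes> inv t"
  have z: "z \<in> carrier G" using y tG by (simp add: z_def)
  have zp: "z [^] p = \<one>"
    using y tG t(2) by (simp add: z_def pow_mult_distrib m_comm nat_pow_inv)
  have zC: "z \<notin> C"
  proof
    assume "z \<in> C"
    then have "z \<otimes> t \<in> C" using t by simp
    then show False using y tG by (simp add: z_def m_assoc)
  qed
  \<comment> \<open>Otherwise \<open>z\<close> and \<open>g\<close> have coprime orders, so both are
    powers of \<open>z \<otimes> g\<close>. Maximality of \<open>C\<close> then puts
    \<open>z \<otimes> g\<close>, and with it \<open>z\<close>, into \<open>C\<close>.\<close>
  have pg: "p dvd ord g"
  proof (rule ccontr)
    assume "\<not> p dvd ord g"
    then have cop: "coprime (int (ord g)) (int p)"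
      using prime_imp_coprime[OF p] coprime_commute by (metis coprime_int_iff)
    let ?h = "z \<otimes> g"
    have h: "?h \<in> carrier G" using z g by simp
    let ?H = "generate G {?h}"
    have H: "subgroup ?H G" using h by (simp add: generate_is_subgroup)
    interpret H: subgroup ?H G by fact
    have hH: "?h \<in> ?H" by (simp add: generate.incl)
    have "?h [^] int (ord g) = z [^] int (ord g)"
      using z g by (simp add: int_pow_int pow_mult_distrib m_comm)
    then have "z [^] int (ord g) \<in> ?H" using subgroup_int_pow_closed[OF H hH] by metis
    moreover have "z [^] int p \<in> ?H" using zp by (simp add: int_pow_int)
    ultimately have zH: "z \<in> ?H"
      using mem_of_coprime_int_pow_mem[OF H z] cop by blast
    then have "inv z \<otimes> ?h \<in> ?H" using hH by blast
    then have "g \<in> ?H" using z g by (simp flip: m_assoc)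
    then have "?h \<in> C" using max[OF h] by (simp add: C_def)
    then have "?h \<otimes> inv g \<in> C" using gC1 by blast
    then show False using z g zC by (simp add: m_assoc)
  qed
  define w where "w = g [^] (ord g div p)"
  have w: "w \<in> carrier G" using g by (simp add: w_def)
  have wC: "w \<in> C" using gC[of "int (ord g div p)"] by (simp add: w_def int_pow_int)
  show thesis
  proof (rule that[of p z w])
    show "w [^] p = \<one>" using g pg by (simp add: w_def nat_pow_pow)
    have "ord g > 0" using ord_ge_1[OF fin g] by simp
    then have "0 < ord g div p" "ord g div p < ord g"
      using pg prime_gt_1_nat[OF p] by (simp_all add: dvd_imp_le div_greater_zero_iff)
    then have "\<not> ord g dvd ord g div p" using nat_dvd_not_less by blast
    then show "w \<noteq> \<one>" using g by (simp add: w_def pow_eq_id)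
    show "z \<notin> generate G {w}"
      using zC generate_singleton_subset_iff[OF subC w] wC by blast
  qed (use p z w zp in auto)
qed

section \<open>Maximal subgroups of abelian groups\<close>

lemma (in group) subset_set_mult:
  assumes "subgroup H G" "subgroup K G"
  shows "H \<subseteq> H <#> K" "K \<subseteq> H <#> K"
proof -
  interpret H: subgroup H G by fact
  interpret K: subgroup K G by fact
  show "H \<subseteq> H <#> K"
  proof
    fix x assume "x \<in> H"
    then have "x \<otimes> \<one> \<in> H <#> K" unfolding set_mult_def using K.one_closed by blast
    then show "x \<in> H <#> K" using \<open>x \<in> H\<close> by simp
  qed
  show "K \<subseteq> H <#> K"
  proof
    fix x assume "x \<in> K"
    then have "\<one> \<otimes> x \<in> H <#> K" unfolding set_mult_def using H.one_closed by blast
    then show "x \<in> H <#> K" using \<open>x \<in> K\<close> by simp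
  qed
qed

text \<open>In an abelian group \<open>K <#> L\<close> is a subgroup above both factors. If it were
  proper, maximality would make it equal to both \<open>K\<close> and \<open>L\<close>.\<close>

lemma (in comm_group) maximal_subgroups_set_mult:
  assumes "K \<in> maximal_subgroups G" "L \<in> maximal_subgroups G" "K \<noteq> L"
  shows "K <#> L = carrier G"
proof -
  have K: "subgroup K G" and L: "subgroup L G" using assms by (auto simp: maximal_subgroups_def)
  have "subgroup (K <#> L) G" by (rule mult_subgroups[OF K L])
  moreover have "K \<subseteq> K <#> L" "L \<subseteq> K <#> L"
    using subset_set_mult[OF K L] by simp_all
  ultimately show ?thesis using assms unfolding maximal_subgroups_def by blast
qed

text \<open>Choose \<open>K\<close> maximal among the subgroups containing \<open>W\<close> and
  avoiding \<open>x\<close>. The prime exponent is what makes \<open>K\<close> maximal among all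
  proper subgroups.\<close>

lemma (in comm_group) maximal_subgroup_separating:
  assumes fin: "finite (carrier G)" and p: "Factorial_Ring.prime (p::nat)"
    and exp: "\<And>x. x \<in> carrier G \<Longrightarrow> x [^] p = \<one>"
    and W: "subgroup W G" and x: "x \<in> carrier G" "x \<notin> W"
  obtains K where "K \<in> maximal_subgroups G" "W \<subseteq> K" "x \<notin> K"
proof -
  let ?M = "{M. subgroup M G \<and> W \<subseteq> M \<and> x \<notin> M}"
  have "finite ?M"
    by (rule finite_subset[of _ "Pow (carrier G)"]) (auto simp: fin dest: subgroup.subset)
  moreover have "?M \<noteq> {}" using W x by blast
  ultimately obtain K where K: "K \<in> ?M" and "\<forall>M\<in>?M. K \<subseteq> M \<longrightarrow> K = M"
    using finite_has_maximal[of ?M] by auto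
  then have max: "\<And>M. M \<in> ?M \<Longrightarrow> K \<subseteq> M \<Longrightarrow> K = M" by blast
  have subK: "subgroup K G" using K by blast
  interpret K: subgroup K G by fact
  have "L = carrier G" if L: "subgroup L G" and KL: "K \<subseteq> L" and ne: "L \<noteq> K" for L
  proof (rule ccontr)
    assume "L \<noteq> carrier G"
    interpret L: subgroup L G by fact
    obtain y where y: "y \<in> carrier G" "y \<notin> L" using \<open>L \<noteq> carrier G\<close> L.subset by blast
    have xL: "x \<in> L" using max[of L] K L KL ne by blast
    have Y: "subgroup (generate G {y}) G" using y by (simp add: generate_is_subgroup)
    interpret Y: subgroup "generate G {y}" G by fact
    \<comment> \<open>As \<open>?S\<close> is strictly above \<open>K\<close>, it contains
      \<open>x = k \<otimes> y [^] i\<close>, and then \<open>y [^] i\<close> lies in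
      \<open>L\<close>. If \<open>p\<close> divides \<open>i\<close>, this gives
      \<open>x = k\<close> in \<open>K\<close>; otherwise it gives \<open>y\<close> in
      \<open>L\<close>.\<close>
    let ?S = "K <#> generate G {y}"
    have S: "subgroup ?S G" by (rule mult_subgroups[OF subK Y])
    have "y \<in> ?S" "K \<subseteq> ?S"
      using subset_set_mult[OF subK Y] generate.incl[of y "{y}" G] by auto
    then have "x \<in> ?S" using max[of ?S] S K KL y by blast
    then obtain k i where ki: "k \<in> K" "x = k \<otimes> y [^] (i::int)"
      using y unfolding set_mult_def by (auto simp: generate_pow)
    have "inv k \<otimes> x \<in> L" using xL ki KL by blast
    then have yi: "y [^] i \<in> L" using ki y by (simp flip: m_assoc)
    show False
    proof (cases "int p dvd i")
      case True
      then have "y [^] i = \<one>"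
        using exp[OF y(1)] y by (metis dvdE int_pow_int int_pow_one int_pow_pow)
      then show False using ki K by simp
    next
      case False
      then have "coprime (int p) i" using p prime_imp_coprime[of "int p"] by simp
      moreover have "y [^] int p \<in> L" using exp y by (simp add: int_pow_int)
      ultimately show False using mem_of_coprime_int_pow_mem[OF L y(1)] yi y by blast
    qed
  qed
  moreover have "K \<noteq> carrier G" using K x by blast
  ultimately have "K \<in> maximal_subgroups G" using subK by (auto simp: maximal_subgroups_def)
  then show thesis using that K by blast
qed

text \<open>Choose \<open>K0\<close> to contain \<open>w\<close> and avoid \<open>z\<close>. If
  \<open>x\<close> lies in \<open>K0\<close>, any maximal subgroup avoiding \<open>x\<close> differs
  from \<open>K0\<close>. If not, one that avoids \<open>x\<close> but contains
  \<open>x \<otimes> w\<close> differs from \<open>K0\<close>, since \<open>x \<otimes> w\<close> is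
  outside \<open>K0\<close>.\<close>

lemma (in comm_group) exists_redundant_maximal_subgroup:
  assumes fin: "finite (carrier G)" and p: "Factorial_Ring.prime (p::nat)"
    and exp: "\<And>x. x \<in> carrier G \<Longrightarrow> x [^] p = \<one>"
    and zw: "z \<in> carrier G" "w \<in> carrier G" "w \<noteq> \<one>" "z \<notin> generate G {w}"
  obtains K0 where "K0 \<in> maximal_subgroups G"
    "\<And>x. x \<in> carrier G \<Longrightarrow> x \<noteq> \<one> \<Longrightarrow> \<exists>K\<in>maximal_subgroups G - {K0}. x \<notin> K"
proof -
  have "subgroup (generate G {w}) G" using zw by (simp add: generate_is_subgroup)
  then obtain K0 where K0: "K0 \<in> maximal_subgroups G" "generate G {w} \<subseteq> K0"
    using maximal_subgroup_separating[OF fin p exp _ zw(1,4)] by metis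
  have sub0: "subgroup K0 G" using K0 by (simp add: maximal_subgroups_def)
  interpret K0: subgroup K0 G by fact
  have w: "w \<in> K0" using K0 generate.incl[of w "{w}" G] by blast
  have "\<exists>K\<in>maximal_subgroups G - {K0}. x \<notin> K" if x: "x \<in> carrier G" "x \<noteq> \<one>" for x
  proof (cases "x \<in> K0")
    case True
    obtain K where "K \<in> maximal_subgroups G" "x \<notin> K"
      using maximal_subgroup_separating[OF fin p exp triv_subgroup x(1)] x(2) by blast
    then show ?thesis using True by blast
  next
    case False
    have xw: "x \<otimes> w \<in> carrier G" using x zw by simp
    have G: "subgroup (generate G {x \<otimes> w}) G" using xw by (simp add: generate_is_subgroup)
    \<comment> \<open>From \<open>x = (x \<otimes> w) [^] i\<close> it follows that
      \<open>x [^] (i - 1)\<close> is in \<open>K0\<close>; as \<open>x\<close> is not,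
      \<open>p\<close> divides \<open>i - 1\<close>. Hence \<open>w [^] i = \<one>\<close> with
      \<open>i\<close> prime to \<open>p\<close>, which contradicts
      \<open>w \<noteq> \<one>\<close>.\<close>
    have notin: "x \<notin> generate G {x \<otimes> w}"
    proof
      assume "x \<in> generate G {x \<otimes> w}"
      then obtain i :: int where "x = (x \<otimes> w) [^] i" using xw by (auto simp: generate_pow)
      then have i: "x = x [^] i \<otimes> w [^] i" using x zw by (simp add: int_pow_distrib)
      have "x [^] (i - 1) \<otimes> w [^] i = inv x \<otimes> (x [^] i \<otimes> w [^] i)"
        using x zw by (simp add: int_pow_diff m_ac)
      also have "\<dots> = inv x \<otimes> x" by (simp only: i[symmetric])
      finally have eq: "x [^] (i - 1) \<otimes> w [^] i = \<one>" using x by simp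
      then have "x [^] (i - 1) = inv (w [^] i)" using x zw by (simp add: inv_equality)
      then have mem: "x [^] (i - 1) \<in> K0"
        using subgroup_int_pow_closed[OF sub0 w] by simp
      have "x [^] int p \<in> K0" using exp x by (simp add: int_pow_int)
      then have "\<not> coprime (int p) (i - 1)"
        using mem_of_coprime_int_pow_mem[OF sub0 x(1)] mem False by blast
      then have "int p dvd i - 1" using p prime_imp_coprime[of "int p"] by auto
      then have "x [^] (i - 1) = \<one>"
        using exp[OF x(1)] x by (metis dvdE int_pow_int int_pow_one int_pow_pow)
      then have "w [^] i = \<one>" using eq zw by simp
      moreover have "w [^] int p = \<one>" using exp zw by (simp add: int_pow_int)
      moreover have "coprime (int p) i"
      proof -
        have "\<not> int p dvd i"
        proof
          assume "int p dvd i"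
          then have "int p dvd 1" using \<open>int p dvd i - 1\<close> by (metis dvd_diff_right_iff)
          then show False using p by simp
        qed
        then show ?thesis using p prime_imp_coprime[of "int p"] by auto
      qed
      ultimately have "w \<in> {\<one>}"
        using mem_of_coprime_int_pow_mem[OF triv_subgroup zw(2)] by blast
      then show False using zw by blast
    qed
    obtain K where K: "K \<in> maximal_subgroups G" "generate G {x \<otimes> w} \<subseteq> K" "x \<notin> K"
      using maximal_subgroup_separating[OF fin p exp G x(1) notin] by metis
    have "x \<otimes> w \<notin> K0"
    proof
      assume "x \<otimes> w \<in> K0"
      then have "x \<otimes> w \<otimes> inv w \<in> K0" using w by blast
      then show False using False x zw by (simp add: m_assoc)
    qed
    then show ?thesis using K generate.incl[of "x \<otimes> w" "{x \<otimes> w}" G] by blast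
  qed
  then show thesis using that K0(1) by blast
qed

section \<open>The action on the cosets of a family of subgroups closed under conjugation\<close>

text \<open>Abstracts from the maximal subgroups of \<open>V\<close> what the action requires. By
  \<open>conj_F\<close>, left multiplication permutes the right cosets of all members of
  \<open>F\<close> together.\<close>

locale coset_family = group +
  fixes V :: "'a set" and F :: "'a set set"
  assumes normal_V: "V \<lhd> G"
    and commute_V: "x \<in> V \<Longrightarrow> y \<in> V \<Longrightarrow> x \<otimes> y = y \<otimes> x"
    and subgroup_F: "K \<in> F \<Longrightarrow> subgroup K G"
    and F_subset: "K \<in> F \<Longrightarrow> K \<subseteq> V"
    and conj_F: "x \<in> carrier G \<Longrightarrow> K \<in> F \<Longrightarrow> x <# K #> inv x \<in> F"
begin

text \<open>A plain union serves as the disjoint union of the coset spaces, because a set is a right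
  coset of only one subgroup (\<open>rcoset_eq_imp_subgroup_eq\<close>).\<close>

definition cosets :: "'a set set"
  where "cosets = (\<Union>K\<in>F. rcosets K)"

definition act :: "'a \<Rightarrow> 'a set \<Rightarrow> 'a set"
  where "act x = (\<lambda>S\<in>cosets. x <# S)"

lemma subgroup_V: "subgroup V G"
  using normal_V by (rule normal_imp_subgroup)

lemma V_carrier: "x \<in> V \<Longrightarrow> x \<in> carrier G"
  using subgroup.subset[OF subgroup_V] by blast

lemma F_carrier: "K \<in> F \<Longrightarrow> K \<subseteq> carrier G"
  using subgroup.subset[OF subgroup_F] .

lemma cosets_iff: "S \<in> cosets \<longleftrightarrow> (\<exists>K\<in>F. \<exists>g\<in>carrier G. S = K #> g)"
  by (auto simp: cosets_def RCOSETS_def)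

lemma F_cosets: "K \<in> F \<Longrightarrow> K \<in> cosets"
  unfolding cosets_iff using coset_mult_one[OF F_carrier] by (metis one_closed)

lemma cosets_carrier: "S \<in> cosets \<Longrightarrow> S \<subseteq> carrier G"
  using F_carrier r_coset_subset_G unfolding cosets_iff by metis

text \<open>Insert \<open>inv x \<otimes> x\<close> between \<open>K\<close> and \<open>g\<close>:
  the subgroup indexing a coset moves to its conjugate.\<close>

lemma l_coset_rcoset:
  assumes "K \<in> F" "x \<in> carrier G" "g \<in> carrier G"
  shows "x <# (K #> g) = (x <# K #> inv x) #> (x \<otimes> g)"
proof -
  have "(x <# K #> inv x) #> (x \<otimes> g) = (x <# K) #> (inv x \<otimes> (x \<otimes> g))"
    using assms F_carrier l_coset_subset_G by (simp add: coset_mult_assoc)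
  also have "inv x \<otimes> (x \<otimes> g) = g" using assms by (simp flip: m_assoc)
  finally show ?thesis using assms F_carrier by (simp add: coset_assoc)
qed

text \<open>Since \<open>V\<close> is abelian, \<open>x\<close> commutes past \<open>K\<close>.
  Elements of \<open>V\<close> therefore keep each coset within \<open>rcosets K\<close>.\<close>

lemma V_l_coset_rcoset:
  assumes "K \<in> F" "x \<in> V" "g \<in> carrier G"
  shows "x <# (K #> g) = K #> (x \<otimes> g)"
proof -
  have "x <# K = K #> x"
    unfolding l_coset_def r_coset_def using assms F_subset[OF assms(1)] commute_V
    by (metis (no_types, lifting) SUP_cong subset_iff)
  then show ?thesis using assms F_carrier V_carrier by (simp add: coset_assoc coset_mult_assoc)
qed

lemma l_coset_cosets: "x \<in> carrier G \<Longrightarrow> S \<in> cosets \<Longrightarrow> x <# S \<in> cosets"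
  using l_coset_rcoset conj_F unfolding cosets_iff by (metis m_closed)

lemma l_coset_inj:
  assumes "x \<in> carrier G" "S \<subseteq> carrier G" "T \<subseteq> carrier G" "x <# S = x <# T"
  shows "S = T"
proof -
  have "inv x <# (x <# S) = inv x <# (x <# T)" using assms by simp
  then show ?thesis using assms(1-3) by (simp add: lcos_m_assoc lcos_mult_one)
qed

lemma act_Bij:
  assumes "x \<in> carrier G" shows "act x \<in> Bij cosets"
proof -
  have "inj_on (act x) cosets"
    using l_coset_inj[OF assms] cosets_carrier by (auto simp: act_def inj_on_def)
  moreover have "act x ` cosets = cosets"
  proof
    show "act x ` cosets \<subseteq> cosets" using l_coset_cosets assms by (auto simp: act_def)
    show "cosets \<subseteq> act x ` cosets"
    proof
      fix S assume S: "S \<in> cosets"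
      have "inv x <# S \<in> cosets" using S l_coset_cosets assms by simp
      moreover have "act x (inv x <# S) = S"
        using S cosets_carrier assms calculation
        by (simp add: act_def lcos_m_assoc lcos_mult_one)
      ultimately show "S \<in> act x ` cosets" by (metis image_eqI)
    qed
  qed
  ultimately show ?thesis by (simp add: Bij_def bij_betw_def act_def)
qed

text \<open>Identifies the stabilizer of the point \<open>K\<close>; faithfulness and the final
  contradiction are both read off at such points.\<close>

lemma l_coset_fixes_subgroup_iff:
  assumes "subgroup K G" "x \<in> carrier G"
  shows "x <# K = K \<longleftrightarrow> x \<in> K"
proof
  assume "x <# K = K"
  then show "x \<in> K" using lcos_self[OF assms(2,1)] by simp
next
  assume "x \<in> K"
  then show "x <# K = K"
    using l_repr_independence[of x \<one> K] assms lcos_mult_one[of K] subgroup.subset[OF assms(1)] by simp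
qed

lemma group_action_act: "group_action G cosets act"
proof (intro group_action.intro group_hom.intro group_hom_axioms.intro homI group_BijGroup)
  show "group G" ..
  show "act x \<in> carrier (BijGroup cosets)" if "x \<in> carrier G" for x
    using act_Bij that by (simp add: BijGroup_simps)
  fix x y assume xy: "x \<in> carrier G" "y \<in> carrier G"
  have "act (x \<otimes> y) = compose cosets (act x) (act y)"
  proof (rule extensionalityI[of _ cosets])
    fix S assume "S \<in> cosets"
    then show "act (x \<otimes> y) S = compose cosets (act x) (act y) S"
      using xy by (simp add: act_def compose_eq l_coset_cosets cosets_carrier lcos_m_assoc)
  qed (auto simp: act_def)
  then show "act (x \<otimes> y) = act x \<otimes>\<^bsub>BijGroup cosets\<^esub> act y"
    using xy act_Bij by (simp add: BijGroup_simps)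
qed

text \<open>If \<open>x\<close> and \<open>y\<close> act alike at every point \<open>K\<close> of
  \<open>F\<close>, then \<open>inv y \<otimes> x\<close> lies in all these \<open>K\<close>, hence
  in \<open>V\<close>, where the second assumption makes it trivial.\<close>

lemma faithful_action_act:
  assumes "F \<noteq> {}" "\<And>x. x \<in> V \<Longrightarrow> x \<noteq> \<one> \<Longrightarrow> \<exists>K\<in>F. x \<notin> K"
  shows "faithful_action G cosets act"
proof (intro faithful_action.intro faithful_action_axioms.intro group_action_act inj_onI)
  fix x y assume xy: "x \<in> carrier G" "y \<in> carrier G" and eq: "act x = act y"
  have *: "inv y \<otimes> x \<in> K" if K: "K \<in> F" for K
  proof -
    have "x <# K = y <# K" using eq F_cosets[OF K] by (metis act_def restrict_apply')
    then have "inv y <# (x <# K) = inv y <# (y <# K)" by simp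
    then have "(inv y \<otimes> x) <# K = K"
      using xy F_carrier[OF K] by (simp add: lcos_m_assoc lcos_mult_one)
    then show ?thesis using l_coset_fixes_subgroup_iff[OF subgroup_F[OF K]] xy by simp
  qed
  then have "inv y \<otimes> x = \<one>" using assms F_subset by blast
  then show "x = y" using xy by (metis inv_equality inv_inv inv_closed)
qed

text \<open>Equal cosets share the representative \<open>g\<close>, which can be cancelled. So the
  index \<open>K\<close> of a coset is well defined.\<close>

lemma rcoset_eq_imp_subgroup_eq:
  assumes "K \<in> F" "L \<in> F" "g \<in> carrier G" "h \<in> carrier G" "K #> g = L #> h"
  shows "K = L"
proof -
  have "g \<in> L #> h" using assms rcos_self subgroup_F by metis
  then have "K #> g = L #> g" using assms repr_independence[of g L h] subgroup_F by simp
  then have "K #> g #> inv g = L #> g #> inv g" by simp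
  then show ?thesis using assms(1-3) F_carrier by (simp add: coset_mult_assoc)
qed

section \<open>A permutation in the 2-closure that acts on the cosets of one subgroup only\<close>

definition twist :: "'a set \<Rightarrow> 'a \<Rightarrow> 'a set \<Rightarrow> 'a set"
  where "twist K v = (\<lambda>S\<in>cosets. if S \<in> rcosets K then v <# S else S)"

text \<open>Both branches become multiplication by an element of \<open>V\<close> that depends only
  on the index \<open>K\<close>, so they can be treated uniformly.\<close>

lemma twist_rcoset:
  assumes "K0 \<in> F" "v \<in> V" "K \<in> F" "g \<in> carrier G"
  shows "twist K0 v (K #> g) = (if K = K0 then v else \<one>) <# (K #> g)"
proof -
  have "K #> g \<in> cosets" using assms by (auto simp: cosets_iff)
  moreover have "K #> g \<in> rcosets K0 \<longleftrightarrow> K = K0"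
    using rcoset_eq_imp_subgroup_eq assms by (auto simp: RCOSETS_def)
  ultimately show ?thesis
    using cosets_carrier by (simp add: twist_def lcos_mult_one)
qed

text \<open>
  For \<open>K \<noteq> L\<close>, the condition \<open>K <#> L = V\<close> makes the system \<open>x \<equiv> s\<close> mod \<open>K\<close>, \<open>x \<equiv> t\<close> mod \<open>L\<close>
  solvable in \<open>V\<close>.
\<close>

lemma twist_pair:
  assumes prod: "\<And>K L. K \<in> F \<Longrightarrow> L \<in> F \<Longrightarrow> K \<noteq> L \<Longrightarrow> K <#> L = V"
    and K0: "K0 \<in> F" and v: "v \<in> V" and "S \<in> cosets" "T \<in> cosets"
  shows "\<exists>x\<in>carrier G. twist K0 v S = act x S \<and> twist K0 v T = act x T"
proof -
  obtain K g where K: "K \<in> F" "g \<in> carrier G" "S = K #> g" using assms by (auto simp: cosets_iff)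
  obtain L h where L: "L \<in> F" "h \<in> carrier G" "T = L #> h" using assms by (auto simp: cosets_iff)
  interpret V: subgroup V G by (rule subgroup_V)
  define s where "s = (if K = K0 then v else \<one>)"
  define t where "t = (if L = K0 then v else \<one>)"
  have sV: "s \<in> V" and tV: "t \<in> V" using v by (auto simp: s_def t_def)
  have "\<exists>x\<in>V. x <# S = s <# S \<and> x <# T = t <# T"
  proof (cases "K = L")
    case True
    then show ?thesis using sV by (auto simp: s_def t_def)
  next
    case False
    interpret K: subgroup K G using K by (simp add: subgroup_F)
    interpret L: subgroup L G using L by (simp add: subgroup_F)
    \<comment> \<open>The twist moves \<open>S\<close> by \<open>s\<close> and \<open>T\<close> by
      \<open>t\<close>. Factoring \<open>inv s \<otimes> t\<close> as \<open>k \<otimes> l\<close>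
      yields \<open>x = s \<otimes> k\<close>, which differs from \<open>s\<close> by an element of
      \<open>K\<close> and from \<open>t\<close> by an element of \<open>L\<close>.\<close>
    have "inv s \<otimes> t \<in> K <#> L" using prod[OF K(1) L(1) False] sV tV by simp
    then obtain k l where kl: "k \<in> K" "l \<in> L" "inv s \<otimes> t = k \<otimes> l"
      unfolding set_mult_def by blast
    have kV: "k \<in> V" and lV: "l \<in> V" using kl F_subset K L by auto
    note V = sV tV kV lV
    define x where "x = s \<otimes> k"
    have xV: "x \<in> V" using V by (simp add: x_def)
    have xk: "x = k \<otimes> s" using V commute_V by (simp add: x_def)
    have "t = s \<otimes> (inv s \<otimes> t)" using V by (simp flip: m_assoc)
    also have "\<dots> = x \<otimes> l" using V kl by (simp add: x_def m_assoc)
    also have "\<dots> = l \<otimes> x" using xV lV commute_V by blast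
    finally have tl: "t = l \<otimes> x" .
    have absorb: "M #> (m \<otimes> a) = M #> a" if "M \<in> F" "m \<in> M" "a \<in> carrier G" for M m a
    proof -
      interpret M: subgroup M G by (rule subgroup_F[OF that(1)])
      have "M #> (m \<otimes> a) = M #> m #> a" using that M.subset by (simp add: coset_mult_assoc)
      then show ?thesis using that M.rcos_const[OF is_group] by simp
    qed
    have "x <# S = s <# S"
      using K V xV kl by (simp add: V_l_coset_rcoset xk m_assoc absorb)
    moreover have "x <# T = t <# T"
      using L V xV kl by (simp add: V_l_coset_rcoset tl m_assoc absorb)
    ultimately show ?thesis using xV by blast
  qed
  then obtain x where x: "x \<in> V" "x <# S = s <# S" "x <# T = t <# T" by blast
  then have "twist K0 v S = act x S \<and> twist K0 v T = act x T"
    using twist_rcoset[OF K0 v] K L assms(4,5) by (simp add: act_def s_def t_def)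
  then show ?thesis using x V_carrier by blast
qed

text \<open>Twisting preserves the index of each coset, so the twist by \<open>inv v\<close> undoes
  the twist by \<open>v\<close>.\<close>

lemma twist_Bij:
  assumes K0: "K0 \<in> F" and v: "v \<in> V"
  shows "twist K0 v \<in> Bij cosets"
proof -
  interpret V: subgroup V G by (rule subgroup_V)
  have inverse: "twist K0 (inv u) (twist K0 u S) = S" and closed: "twist K0 u S \<in> cosets"
    if u: "u \<in> V" and "S \<in> cosets" for u S
  proof -
    obtain K g where K: "K \<in> F" "g \<in> carrier G" "S = K #> g"
      using \<open>S \<in> cosets\<close> by (auto simp: cosets_iff)
    define s where "s = (if K = K0 then u else \<one>)"
    have s: "s \<in> V" "(if K = K0 then inv u else \<one>) = inv s" using u by (auto simp: s_def)
    have eq: "twist K0 u S = K #> (s \<otimes> g)"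
      using twist_rcoset[OF K0 u] K s V_l_coset_rcoset by (simp add: s_def)
    show "twist K0 u S \<in> cosets" unfolding eq cosets_iff using K s V.mem_carrier by blast
    have "twist K0 (inv u) (twist K0 u S) = inv s <# (K #> (s \<otimes> g))"
      unfolding eq using twist_rcoset[OF K0, of "inv u" K "s \<otimes> g"] K s u by simp
    also have "\<dots> = K #> (inv s \<otimes> (s \<otimes> g))" using K s by (simp add: V_l_coset_rcoset)
    also have "\<dots> = S" using K s by (simp flip: m_assoc)
    finally show "twist K0 (inv u) (twist K0 u S) = S" .
  qed
  have "bij_betw (twist K0 v) cosets cosets"
  proof (rule bij_betw_byWitness[where f' = "twist K0 (inv v)"])
    show "\<forall>S\<in>cosets. twist K0 v (twist K0 (inv v) S) = S"
      using inverse[of "inv v"] v by simp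
  qed (use inverse closed v in auto)
  then show ?thesis by (simp add: Bij_def twist_def)
qed

text \<open>By \<open>twist_pair\<close> the twist maps each orbit on pairs into itself. It is
  injective and the orbit is finite, so the image is the whole orbit.\<close>

lemma twist_in_two_closure:
  assumes fin: "finite (carrier G)"
    and prod: "\<And>K L. K \<in> F \<Longrightarrow> L \<in> F \<Longrightarrow> K \<noteq> L \<Longrightarrow> K <#> L = V"
    and K0: "K0 \<in> F" and v: "v \<in> V"
  shows "twist K0 v \<in> two_closure G cosets act"
proof -
  interpret A: group_action G cosets act by (rule group_action_act)
  let ?f = "twist K0 v"
  have "map_prod ?f ?f ` \<Delta> = \<Delta>" if D: "\<Delta> \<in> two_orbits G cosets act" for \<Delta>
  proof -
    have sub: "\<Delta> \<subseteq> cosets \<times> cosets" by (rule two_orbits_subset[OF group_action_act D])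
    obtain A B where AB: "A \<in> cosets" "B \<in> cosets"
      and \<Delta>: "\<Delta> = {map_prod (act k) (act k) (A, B) | k. k \<in> carrier G}"
      using D by (auto simp: two_orbits_def orbits_def orbit_def)
    have "map_prod ?f ?f ` \<Delta> \<subseteq> \<Delta>"
    proof
      fix P assume "P \<in> map_prod ?f ?f ` \<Delta>"
      then obtain S T where ST: "(S, T) \<in> \<Delta>" and P: "P = map_prod ?f ?f (S, T)" by auto
      then obtain k where k: "k \<in> carrier G" "S = act k A" "T = act k B" using \<Delta> by auto
      obtain x where x: "x \<in> carrier G" "?f S = act x S" "?f T = act x T"
        using twist_pair[OF prod K0 v] ST sub by blast
      have "P = map_prod (act (x \<otimes> k)) (act (x \<otimes> k)) (A, B)"
        using P x k AB A.composition_rule by simp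
      moreover have "x \<otimes> k \<in> carrier G" using x k by simp
      ultimately show "P \<in> \<Delta>" unfolding \<Delta> by blast
    qed
    moreover have "inj_on (map_prod ?f ?f) \<Delta>"
    proof -
      have "inj_on ?f cosets" using twist_Bij[OF K0 v] by (simp add: Bij_def bij_betw_def)
      then show ?thesis using sub map_prod_inj_on inj_on_subset by blast
    qed
    moreover have "finite \<Delta>"
    proof -
      have "\<Delta> = (\<lambda>k. map_prod (act k) (act k) (A, B)) ` carrier G" using \<Delta> by blast
      then show ?thesis using fin by simp
    qed
    ultimately show ?thesis by (simp add: endo_inj_surj)
  qed
  then show ?thesis using twist_Bij[OF K0 v] by (simp add: two_closure_eq[OF group_action_act])
qed

lemma not_totally_two_closed:
  assumes fin: "finite (carrier G)"
    and prod: "\<And>K L. K \<in> F \<Longrightarrow> L \<in> F \<Longrightarrow> K \<noteq> L \<Longrightarrow> K <#> L = V"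
    and K0: "K0 \<in> F" "K0 \<noteq> V"
    and redundant: "\<And>x. x \<in> V \<Longrightarrow> x \<noteq> \<one> \<Longrightarrow> \<exists>K\<in>F - {K0}. x \<notin> K"
  shows "\<not> totally_two_closed G"
proof
  assume closed: "totally_two_closed G"
  obtain v where v: "v \<in> V" "v \<notin> K0" using K0 F_subset by blast
  have "cosets \<subseteq> Pow (carrier G)" using cosets_carrier by blast
  then have "finite cosets" using fin by (meson finite_Pow_iff finite_subset)
  moreover have "faithful_action G cosets act"
    using faithful_action_act redundant K0 by blast
  ultimately have "act ` carrier G = two_closure G cosets act"
    by (rule totally_two_closedD[OF closed])
  then obtain g where g: "g \<in> carrier G" "twist K0 v = act g"
    using twist_in_two_closure[OF fin prod K0(1) v(1)] by blast
  have fixed: "twist K0 v K = (if K = K0 then v else \<one>) <# K" if "K \<in> F" for K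
    using twist_rcoset[OF K0(1) v(1) that one_closed] F_carrier[OF that] by simp
  have *: "g \<in> K" if K: "K \<in> F - {K0}" for K
  proof -
    have "g <# K = K"
      using fixed[of K] K g F_carrier[of K] F_cosets by (simp add: act_def lcos_mult_one)
    then show ?thesis using l_coset_fixes_subgroup_iff subgroup_F K g by blast
  qed
  \<comment> \<open>The element \<open>v\<close> provides a member of \<open>F\<close> other than
    \<open>K0\<close>. This places \<open>g\<close> in \<open>V\<close>, where
    \<open>redundant\<close> applies and gives \<open>g = \<one>\<close>; but the twist moves the
    point \<open>K0\<close>.\<close>
  have "v \<noteq> \<one>" using v subgroup.one_closed[OF subgroup_F[OF K0(1)]] by blast
  then have "F - {K0} \<noteq> {}" using redundant v by blast
  then have "g \<in> V" using * F_subset by blast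
  then have "g = \<one>" using * redundant by blast
  then have "v <# K0 = K0"
    using fixed[OF K0(1)] g F_cosets K0 F_carrier by (simp add: act_def lcos_mult_one)
  then show False using l_coset_fixes_subgroup_iff subgroup_F K0 V_carrier v by blast
qed

end

section \<open>Conjugation of maximal subgroups of a normal subgroup\<close>

lemma (in group) conj_subgroup:
  assumes H: "subgroup H G" and x: "x \<in> carrier G"
  shows "subgroup (x <# H #> inv x) G"
proof -
  interpret H: subgroup H G by fact
  have mem: "a \<in> x <# H #> inv x \<longleftrightarrow> (\<exists>h\<in>H. a = x \<otimes> h \<otimes> inv x)" for a
    by (auto simp: l_coset_def r_coset_def)
  show ?thesis
  proof (rule subgroupI)
    show "x <# H #> inv x \<subseteq> carrier G" using x by (auto simp: mem)
    show "x <# H #> inv x \<noteq> {}" using mem H.one_closed by blast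
    fix a assume "a \<in> x <# H #> inv x"
    then obtain h where h: "h \<in> H" "a = x \<otimes> h \<otimes> inv x" by (auto simp: mem)
    then have "inv a = x \<otimes> inv h \<otimes> inv x" using x by (simp add: inv_mult_group m_assoc)
    then show "inv a \<in> x <# H #> inv x" using h mem by blast
    fix b assume "b \<in> x <# H #> inv x"
    then obtain k where k: "k \<in> H" "b = x \<otimes> k \<otimes> inv x" by (auto simp: mem)
    have "a \<otimes> b = x \<otimes> (h \<otimes> (inv x \<otimes> x) \<otimes> k) \<otimes> inv x"
      unfolding h k using x h(1) k(1) by (simp only: m_assoc m_closed inv_closed H.mem_carrier)
    then have "a \<otimes> b = x \<otimes> (h \<otimes> k) \<otimes> inv x" using x h by simp
    then show "a \<otimes> b \<in> x <# H #> inv x" using h k mem by blast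
  qed
qed

lemma (in group) conj_conj_inv:
  assumes "H \<subseteq> carrier G" "x \<in> carrier G" "y \<in> carrier G"
  shows "y <# (x <# H #> inv x) #> inv y = (y \<otimes> x) <# H #> inv (y \<otimes> x)"
  using assms by (simp add: coset_assoc lcos_m_assoc coset_mult_assoc l_coset_subset_G
      r_coset_subset_G inv_mult_group)

lemma (in group) conj_mono:
  "H \<subseteq> K \<Longrightarrow> x <# H #> y \<subseteq> x <# K #> y"
  by (auto simp: l_coset_def r_coset_def)

lemma (in group) conj_one: "H \<subseteq> carrier G \<Longrightarrow> \<one> <# H #> inv \<one> = H"
  by (simp add: lcos_mult_one)

lemma (in group) conj_normal:
  assumes "V \<lhd> G" "x \<in> carrier G"
  shows "x <# V #> inv x = V"
proof -
  have V: "V \<subseteq> carrier G" using subgroup.subset[OF normal_imp_subgroup[OF assms(1)]] .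
  have "x <# V = V #> x" using normal.coset_eq[OF assms(1)] assms(2) by simp
  then show ?thesis using V assms(2) by (simp add: coset_mult_assoc)
qed

text \<open>Conjugation by \<open>x\<close> permutes the subgroups of \<open>V\<close> and preserves
  inclusion, with conjugation by \<open>inv x\<close> as inverse. A subgroup \<open>L\<close> above
  the conjugate of \<open>K\<close> is pulled back to one above \<open>K\<close>.\<close>

lemma (in group) conj_maximal_subgroups:
  assumes V: "V \<lhd> G" and x: "x \<in> carrier G" and K: "K \<in> maximal_subgroups (G\<lparr>carrier := V\<rparr>)"
  shows "x <# K #> inv x \<in> maximal_subgroups (G\<lparr>carrier := V\<rparr>)"
proof -
  have subV: "subgroup V G" using normal_imp_subgroup[OF V] .
  \<comment> \<open>Subgroups of \<open>V\<close> are treated as subgroups of \<open>G\<close>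
    contained in \<open>V\<close>, since \<open>x\<close> need not lie in \<open>V\<close>.\<close>
  have iff: "subgroup M (G\<lparr>carrier := V\<rparr>) \<longleftrightarrow> subgroup M G \<and> M \<subseteq> V" for M
    using incl_subgroup[OF subV] subgroup_incl[OF _ subV] subgroup.subset by fastforce
  have KG: "subgroup K G" "K \<subseteq> V" "K \<noteq> V"
    and max: "\<And>L. subgroup L G \<Longrightarrow> L \<subseteq> V \<Longrightarrow> K \<subseteq> L \<Longrightarrow> L = K \<or> L = V"
    using K by (auto simp: maximal_subgroups_def iff)
  have conj_inv: "inv x <# (x <# M #> inv x) #> inv (inv x) = M"
    and inv_conj: "x <# (inv x <# M #> inv (inv x)) #> inv x = M" if "M \<subseteq> carrier G" for M
    using conj_conj_inv[OF that, of x "inv x"] conj_conj_inv[OF that, of "inv x" x]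
      conj_one[OF that] x by simp_all
  have closed: "subgroup (y <# M #> inv y) G \<and> y <# M #> inv y \<subseteq> V"
    if "subgroup M G" "M \<subseteq> V" "y \<in> carrier G" for M y
    using conj_subgroup that conj_mono[OF that(2), of y "inv y"] conj_normal[OF V that(3)] by simp
  have "L = x <# K #> inv x \<or> L = V"
    if L: "subgroup L G" "L \<subseteq> V" "x <# K #> inv x \<subseteq> L" for L
  proof -
    let ?L = "inv x <# L #> inv (inv x)"
    have "K \<subseteq> ?L"
      using conj_mono[OF L(3), of "inv x" "inv (inv x)"] conj_inv subgroup.subset[OF KG(1)] by metis
    then have "?L = K \<or> ?L = V" using max closed[OF L(1,2), of "inv x"] x by blast
    then have "x <# ?L #> inv x = x <# K #> inv x \<or> x <# ?L #> inv x = V"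
      using conj_normal[OF V x] by metis
    then show ?thesis using inv_conj[OF subgroup.subset[OF L(1)]] by simp
  qed
  moreover have "x <# K #> inv x \<noteq> V"
    using conj_inv[OF subgroup.subset[OF KG(1)]] conj_normal[OF V, of "inv x"] x KG(3) by fastforce
  ultimately show ?thesis
    using closed[OF KG(1,2) x] by (auto simp: maximal_subgroups_def iff)
qed

section \<open>The elements killed by a prime in a normal abelian subgroup\<close>

text \<open>Powers distribute over products in the abelian \<open>N\<close>, and conjugation in
  \<open>G\<close> commutes with taking powers.\<close>

lemma (in group) normal_exponent_subgroup:
  assumes N: "N \<lhd> G" and comm: "\<And>x y. x \<in> N \<Longrightarrow> y \<in> N \<Longrightarrow> x \<otimes> y = y \<otimes> x"
  shows "{x \<in> N. x [^] (p::nat) = \<one>} \<lhd> G"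
proof -
  interpret N: normal N G by fact
  have "(x \<otimes> h \<otimes> inv x) [^] p = x \<otimes> h [^] p \<otimes> inv x" if "x \<in> carrier G" "h \<in> carrier G" for x h
  proof (induction p)
    case 0
    then show ?case using that by simp
  next
    case (Suc p)
    have "(x \<otimes> h \<otimes> inv x) [^] Suc p = x \<otimes> h [^] p \<otimes> (inv x \<otimes> x) \<otimes> h \<otimes> inv x"
      unfolding nat_pow_Suc Suc using that
      by (simp only: m_assoc m_closed inv_closed nat_pow_closed)
    then show ?case using that by (simp add: m_assoc)
  qed
  moreover have "\<exists>x. x \<in> N \<and> x [^] p = \<one>" using N.one_closed nat_pow_one by blast
  ultimately show ?thesis
    unfolding normal_inv_iff using comm
    by (auto intro!: subgroupI simp: N.inv_op_closed2 pow_mult_distrib nat_pow_inv)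
qed

theorem theoremB:
  fixes G :: "('a, 'b) monoid_scheme" and N :: "'a set"
  assumes "group G" and "finite (carrier G)" and "carrier G \<noteq> {\<one>\<^bsub>G\<^esub>}"
    and "totally_two_closed G"
    and "N \<lhd> G" and "comm_group (G\<lparr>carrier := N\<rparr>)"
  shows "cyclic_group (G\<lparr>carrier := N\<rparr>)"
proof (rule ccontr)
  assume nc: "\<not> cyclic_group (G\<lparr>carrier := N\<rparr>)"
  interpret group G by fact
  interpret N: normal N G by fact
  interpret CN: comm_group "G\<lparr>carrier := N\<rparr>" by fact
  have comm: "x \<otimes>\<^bsub>G\<^esub> y = y \<otimes>\<^bsub>G\<^esub> x" if "x \<in> N" "y \<in> N" for x y
    using CN.m_comm that by simp
  have pow: "x [^]\<^bsub>G\<lparr>carrier := M\<rparr>\<^esub> n = x [^]\<^bsub>G\<^esub> n" for x M and n :: nat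
    by (simp add: nat_pow_def)
  have "finite N" using assms(2) N.subset finite_subset by blast
  then obtain p z w where p: "Factorial_Ring.prime (p::nat)" and zN: "z \<in> N" and wN: "w \<in> N"
    and zw: "z [^]\<^bsub>G\<^esub> p = \<one>\<^bsub>G\<^esub>" "w [^]\<^bsub>G\<^esub> p = \<one>\<^bsub>G\<^esub>" "w \<noteq> \<one>\<^bsub>G\<^esub>" "z \<notin> generate (G\<lparr>carrier := N\<rparr>) {w}"
    using CN.not_cyclic_obtains_prime_order[OF _ nc] by (auto simp: pow)
  define V where "V = {x \<in> N. x [^]\<^bsub>G\<^esub> p = \<one>\<^bsub>G\<^esub>}"
  have V: "V \<lhd> G" unfolding V_def using normal_exponent_subgroup[OF assms(5) comm] by blast
  have subV: "subgroup V G" using normal_imp_subgroup[OF V] .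
  interpret V: group "G\<lparr>carrier := V\<rparr>" by (rule subgroup_imp_group[OF subV])
  interpret CV: comm_group "G\<lparr>carrier := V\<rparr>"
    by (rule V.group_comm_groupI) (simp add: V_def comm)
  have mem: "z \<in> V" "w \<in> V" using zN wN zw by (auto simp: V_def)
  \<comment> \<open>The subgroup generated by \<open>w\<close> is the same in \<open>V\<close>,
    \<open>N\<close> and \<open>G\<close>, so \<open>z\<close> stays outside it when
    \<open>N\<close> is replaced by \<open>V\<close>.\<close>
  have gen: "generate (G\<lparr>carrier := V\<rparr>) {w} = generate (G\<lparr>carrier := N\<rparr>) {w}"
    using generate_consistent[OF _ subV, of "{w}"]
      generate_consistent[OF _ N.is_subgroup, of "{w}"] mem wN by simp
  have "finite V" using \<open>finite N\<close> by (simp add: V_def)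
  moreover have "x [^]\<^bsub>G\<^esub> p = \<one>\<^bsub>G\<^esub>" if "x \<in> V" for x using that by (simp add: V_def)
  ultimately obtain K0 where K0: "K0 \<in> maximal_subgroups (G\<lparr>carrier := V\<rparr>)"
    "\<And>x. x \<in> V \<Longrightarrow> x \<noteq> \<one>\<^bsub>G\<^esub> \<Longrightarrow> \<exists>K\<in>maximal_subgroups (G\<lparr>carrier := V\<rparr>) - {K0}. x \<notin> K"
    using CV.exists_redundant_maximal_subgroup[of p z w] p mem zw gen by (auto simp: pow)
  interpret coset_family G V "maximal_subgroups (G\<lparr>carrier := V\<rparr>)"
  proof (intro coset_family.intro coset_family_axioms.intro is_group)
    fix K assume "K \<in> maximal_subgroups (G\<lparr>carrier := V\<rparr>)"
    then have K: "subgroup K (G\<lparr>carrier := V\<rparr>)" by (simp add: maximal_subgroups_def)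
    show "subgroup K G" using incl_subgroup[OF subV K] .
    show "K \<subseteq> V" using subgroup.subset[OF K] by simp
  qed (use V conj_maximal_subgroups comm in \<open>auto simp: V_def\<close>)
  have "\<not> totally_two_closed G"
  proof (rule not_totally_two_closed[OF assms(2) _ K0(1) _ K0(2)])
    show "K <#>\<^bsub>G\<^esub> L = V" if "K \<in> maximal_subgroups (G\<lparr>carrier := V\<rparr>)"
      "L \<in> maximal_subgroups (G\<lparr>carrier := V\<rparr>)" "K \<noteq> L" for K L
      using CV.maximal_subgroups_set_mult[OF that] by simp
    show "K0 \<noteq> V" using K0(1) by (simp add: maximal_subgroups_def)
  qed
  then show False using assms(4) by contradiction
qed

end
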